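(* Let $\alpha\in(0,1)$. The unit square $[0,1]^2$ admits fsJN-sequences $\langle\mu_n^1\colon n\in\omega\rangle$, $\langle\mu_n^2\colon n\in\omega\rangle$, $\langle\mu_n^3\colon n\in\omega\rangle$ and $\langle\mu_n^4\colon n\in\omega\rangle$ such that: (1) $\emptyset\neq L(\mu_n^1)\subsetneq LI(\mu_n^1)\subsetneq LS(\mu_n^1)\subsetneq S(\mu_n^1)$; (2) (i) $LS(\mu_n^2)=([0,1]\cap\mathbb{Q})\times\{0\}$, so $LS(\mu_n^2)$ is dense-in-itself; (ii) $\emptyset=L(\mu_n^2)=LI(\mu_n^2)\subsetneq LS(\mu_n^2)\subsetneq S(\mu_n^2)$; (iii) $\mu_n^2(\{x\})\in\{0,1/2\}$ for every $x\in LS(\mu_n^2)$ and $n\in\omega$; (iv) for every $x\in LS(\mu_n^2)$ we have $\limsup_{n\to\infty}\mu_n^2(\{x\})=1/2$, so for every finite $F\subseteq LS(\mu_n^2)$ it holds $\sum_{x\in F}\limsup_{n\to\infty}\mu_n^2(\{x\})=|F|/2$, and hence $\sum_{x\in LS(\mu_n^2)}\limsup_{n\to\infty}\mu_n^2(\{x\})=\infty$; (3) (i) $L(\mu_n^3)=([0,1]\cap\mathbb{Q})\times\{0\}$, so $L(\mu_n^3)$ is dense-in-itself; (ii) $\emptyset\neq L(\mu_n^3)=LI(\mu_n^3)=LS(\mu_n^3)\subsetneq S(\mu_n^3)$; (iii) $\sum_{x\in L(\mu_n^3)}\lim_{n\to\infty}\mu_n^3(\{x\})=(1-\alpha)/2\le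 1/2$ and $\lim_{m\to\infty}\big\|\mu_m^3\restriction L(\mu_n^3)\big\|=(1-\alpha)/2\le 1/2$; (4) (i) $L(\mu_n^4)=\{k/2^{n+1}\colon k,n\in\omega,\ 0\le k<2^{n+1}\}\times\{0\}$; (ii) $\emptyset\neq L(\mu_n^4)=LI(\mu_n^4)=LS(\mu_n^4)=S(\mu_n^4)$; (iii) $\big\|\mu_m^4\restriction L(\mu_n^4)\big\|=1$ for every $m\in\omega$.
   Context: An fsJN-sequence on a compact Hausdorff space $X$ is a sequence $\langle\mu_n\colon n\in\omega\rangle$ of finitely supported signed Radon measures on $X$ with total variation norm $\|\mu_n\|=1$ for every $n$ and $\lim_n\int_X f\,d\mu_n=0$ for every $f\in C(X)$. For a sequence $\langle\mu_n\colon n\in\omega\rangle$ of finitely supported measures on $X$ define (writing $S(\mu_n)$ etc. as abbreviations for sets depending on the whole sequence, in which $n$ is a bound index): $S(\mu_n)=\bigcup_{n\in\omega}\mathrm{supp}(\mu_n)$; $LS(\mu_n)=\{x\in X\colon\limsup_{n\to\infty}|\mu_n(\{x\})|>0\}$; $LI(\mu_n)=\{x\in X\colon\liminf_{n\to\infty}|\mu_n(\{x\})|>0\}$; $L(\mu_n)=\{x\in X\colon\lim_{n\to\infty}\mu_n(\{x\})\text{ exists and is not }0\}$. $\mu\restriction A$ is the restriction of $\mu$ to $A$. A set is dense-in-itself if it has no isolated points in the relative topology. *)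

theory Defs
  imports "HOL-Analysis.Analysis"
begin

definition borel_algebra :: "'a topology \<Rightarrow> 'a measure"
  where "borel_algebra X = sigma (topspace X) {U. openin X U}"

(* A finite signed measure is a real-valued set function; only its values on sets M matter. *)
definition signed_measure :: "'a measure \<Rightarrow> ('a set \<Rightarrow> real) \<Rightarrow> bool"
  where "signed_measure M \<mu> \<longleftrightarrow>
    \<mu> {} = 0 \<and>
    (\<forall>A :: nat \<Rightarrow> 'a set. range A \<subseteq> sets M \<longrightarrow> disjoint_family A \<longrightarrow>
       (\<lambda>i. \<mu> (A i)) sums \<mu> (\<Union>i. A i))"

(* The Jordan decomposition: the positive part of \<mu> at A is the supremum of the
   values \<mu> B over the measurable subsets B of A (ennreal sends negative reals to 0, which is
   harmless as B = {} contributes 0); the negative part is the positive part of -\<mu>. *)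
definition pos_part :: "'a measure \<Rightarrow> ('a set \<Rightarrow> real) \<Rightarrow> 'a measure"
  where "pos_part M \<mu> =
    measure_of (space M) (sets M) (\<lambda>A. SUP B\<in>{B \<in> sets M. B \<subseteq> A}. ennreal (\<mu> B))"

definition neg_part :: "'a measure \<Rightarrow> ('a set \<Rightarrow> real) \<Rightarrow> 'a measure"
  where "neg_part M \<mu> = pos_part M (\<lambda>A. - \<mu> A)"

definition variation :: "'a measure \<Rightarrow> ('a set \<Rightarrow> real) \<Rightarrow> 'a set \<Rightarrow> real"
  where "variation M \<mu> A = measure (pos_part M \<mu>) A + measure (neg_part M \<mu>) A"

definition tv_norm :: "'a measure \<Rightarrow> ('a set \<Rightarrow> real) \<Rightarrow> real"
  where "tv_norm M \<mu> = variation M \<mu> (space M)"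

definition signed_integral :: "'a measure \<Rightarrow> ('a set \<Rightarrow> real) \<Rightarrow> ('a \<Rightarrow> real) \<Rightarrow> real"
  where "signed_integral M \<mu> f =
    integral\<^sup>L (pos_part M \<mu>) f - integral\<^sup>L (neg_part M \<mu>) f"

(* Used for measurable A only. *)
definition restrict_signed :: "('a set \<Rightarrow> real) \<Rightarrow> 'a set \<Rightarrow> 'a set \<Rightarrow> real"
  where "restrict_signed \<mu> A B = \<mu> (B \<inter> A)"

(* Radon: a signed Borel measure whose variation is inner regular with respect to compact sets. *)
definition signed_radon_measure :: "'a topology \<Rightarrow> ('a set \<Rightarrow> real) \<Rightarrow> bool"
  where "signed_radon_measure X \<mu> \<longleftrightarrow>
    signed_measure (borel_algebra X) \<mu> \<and>
    (\<forall>A \<in> sets (borel_algebra X). \<forall>\<epsilon>>0. \<exists>K. compactin X K \<and> K \<in> sets (borel_algebra X) \<and>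
       K \<subseteq> A \<and> variation (borel_algebra X) \<mu> (A - K) < \<epsilon>)"

definition supp :: "'a topology \<Rightarrow> ('a set \<Rightarrow> real) \<Rightarrow> 'a set"
  where "supp X \<mu> = {x \<in> topspace X.
    \<forall>U. openin X U \<longrightarrow> x \<in> U \<longrightarrow> variation (borel_algebra X) \<mu> U > 0}"

definition finitely_supported :: "'a topology \<Rightarrow> ('a set \<Rightarrow> real) \<Rightarrow> bool"
  where "finitely_supported X \<mu> \<longleftrightarrow> finite (supp X \<mu>)"

definition fsJN_sequence :: "'a topology \<Rightarrow> (nat \<Rightarrow> 'a set \<Rightarrow> real) \<Rightarrow> bool"
  where "fsJN_sequence X \<mu> \<longleftrightarrow>
    compact_space X \<and> Hausdorff_space X \<and>
    (\<forall>n. signed_radon_measure X (\<mu> n) \<and> finitely_supported X (\<mu> n) \<and>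
         tv_norm (borel_algebra X) (\<mu> n) = 1) \<and>
    (\<forall>f. continuous_map X euclideanreal f \<longrightarrow>
         (\<lambda>n. signed_integral (borel_algebra X) (\<mu> n) f) \<longlonglongrightarrow> 0)"

definition S_set :: "'a topology \<Rightarrow> (nat \<Rightarrow> 'a set \<Rightarrow> real) \<Rightarrow> 'a set"
  where "S_set X \<mu> = (\<Union>n. supp X (\<mu> n))"

definition LS_set :: "'a topology \<Rightarrow> (nat \<Rightarrow> 'a set \<Rightarrow> real) \<Rightarrow> 'a set"
  where "LS_set X \<mu> = {x \<in> topspace X. limsup (\<lambda>n. ereal \<bar>\<mu> n {x}\<bar>) > 0}"

definition LI_set :: "'a topology \<Rightarrow> (nat \<Rightarrow> 'a set \<Rightarrow> real) \<Rightarrow> 'a set"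
  where "LI_set X \<mu> = {x \<in> topspace X. liminf (\<lambda>n. ereal \<bar>\<mu> n {x}\<bar>) > 0}"

definition L_set :: "'a topology \<Rightarrow> (nat \<Rightarrow> 'a set \<Rightarrow> real) \<Rightarrow> 'a set"
  where "L_set X \<mu> = {x \<in> topspace X. \<exists>l. l \<noteq> 0 \<and> (\<lambda>n. \<mu> n {x}) \<longlonglongrightarrow> l}"

definition dense_in_itself :: "'a topology \<Rightarrow> 'a set \<Rightarrow> bool"
  where "dense_in_itself X A \<longleftrightarrow>
    A \<subseteq> topspace X \<and> \<not> (\<exists>x\<in>A. openin (subtopology X A) {x})"

definition unit_square :: "(real \<times> real) topology"
  where "unit_square = top_of_set ({0..1} \<times> {0..1})"

end

theory Submission
  imports Defs
begin

text \<open>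
  All four sequences consist of dipoles.  Let \<open>\<mu> n\<close> be a finite sum of terms
  \<open>c k * (\<delta> (p k) - \<delta> (q k))\<close>, where the ends of the dipoles are distinct points, the weights are
  nonnegative with sum \<open>1/2\<close>, and all distances between \<open>p k\<close> and \<open>q k\<close> are at most \<open>\<epsilon> n\<close> with
  \<open>\<epsilon> n\<close> tending to \<open>0\<close>.  Then \<open>\<mu> n\<close> has norm \<open>1\<close>, and the integrals of a continuous function tend
  to \<open>0\<close> by its uniform continuity (\<open>fsJN_sequence_\<mu>\<close>).  What remains is to choose ends and
  weights such that the values at points behave as required.

  In the first three sequences the dipoles are vertical: each one stands over a point of the unit
  interval and its upper end has height \<open>1 / (n + 1)\<close>.  A given point off the axis is an end of a
  dipole finitely often, so only points on the axis can belong to \<open>LS_set\<close>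
  (\<open>LS_set_subset_height_le_0\<close>).  For the first one, three dipoles with alternating weights suffice.  For the second one,
  a single dipole visits every rational infinitely often.  For the third one, the dipole over the \<open>k\<close>-th
  rational has weight \<open>(1 - \<alpha>) / 2 ^ (k + 2)\<close> from some time on, and the weight missing to \<open>1/2\<close> is
  put on one further dipole off the axis.

  In the fourth sequence the support may not leave the axis, and the dipoles join points of a countable
  dense-in-itself set \<open>D\<close>.  The negative ends are taken so late in an enumeration of \<open>D\<close> that each
  point is a negative end at finitely many stages only, and from then on a positive one with an
  eventually constant weight (\<open>fsJN_all_limit_sets_equal\<close>).

  Norm, integral and support of such measures are the expected finite sums and sets because the
  Jordan decomposition of a finite sum of atoms separates the positive from the negative weights
  (\<open>pos_part_atoms\<close>).
\<close>

section \<open>Finite sums of atoms\<close>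

text \<open>The signed measure with weight \<open>a j\<close> at the point \<open>z j\<close>.  Indexing the atoms rather than
  taking a weight function on the space lets the two ends of a dipole be indexed by a disjoint
  sum.\<close>
definition atoms :: "'i set \<Rightarrow> ('i \<Rightarrow> real) \<Rightarrow> ('i \<Rightarrow> 'a) \<Rightarrow> 'a set \<Rightarrow> real"
  where "atoms J a z A = (\<Sum>j\<in>J. a j * indicator A (z j))"

lemma space_borel_algebra: "space (borel_algebra X) = topspace X"
  unfolding borel_algebra_def by (rule space_measure_of) (auto dest: openin_subset)

lemma sets_borel_algebra_openin:
  assumes "openin X U"
  shows "U \<in> sets (borel_algebra X)"
proof -
  have "{U. openin X U} \<subseteq> Pow (topspace X)"
    by (auto dest: openin_subset)
  then show ?thesis
    using assms unfolding borel_algebra_def by (simp add: sets_measure_of sigma_sets.Basic)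
qed

lemma sets_borel_algebra_closedin:
  assumes "closedin X C"
  shows "C \<in> sets (borel_algebra X)"
proof -
  have "space (borel_algebra X) - (topspace X - C) \<in> sets (borel_algebra X)"
    using assms by (intro sets.compl_sets sets_borel_algebra_openin) (simp add: closedin_def)
  moreover have "topspace X - (topspace X - C) = C"
    using closedin_subset[OF assms] by blast
  ultimately show ?thesis
    by (simp add: space_borel_algebra)
qed

lemma continuous_map_imp_borel_measurable:
  fixes f :: "'a \<Rightarrow> real"
  assumes "continuous_map X euclideanreal f"
  shows "f \<in> borel_measurable (borel_algebra X)"
proof (rule borel_measurableI)
  fix S :: "real set" assume "open S"
  then have "openin X {x \<in> topspace X. f x \<in> S}"
    using openin_continuous_map_preimage[OF assms, of S] by simp
  moreover have "f -` S \<inter> topspace X = {x \<in> topspace X. f x \<in> S}"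
    by auto
  ultimately show "f -` S \<inter> space (borel_algebra X) \<in> sets (borel_algebra X)"
    by (simp add: space_borel_algebra sets_borel_algebra_openin)
qed

context
  fixes X :: "'a topology" and J :: "'i set" and z :: "'i \<Rightarrow> 'a"
  assumes t1: "t1_space X" and fin: "finite J" and inj: "inj_on z J"
    and sub: "z ` J \<subseteq> topspace X"
begin

lemma sets_subset_atoms:
  assumes "B \<subseteq> z ` J"
  shows "B \<in> sets (borel_algebra X)"
proof -
  have "finite B" "B \<subseteq> topspace X"
    using assms fin sub by (auto dest: finite_subset)
  then have "closedin X B"
    using t1 by (simp add: t1_space_closedin_finite)
  then show ?thesis
    by (rule sets_borel_algebra_closedin)
qed

lemma measurable_atoms: "z \<in> measurable (point_measure J w) (borel_algebra X)"
  using sub by (auto simp: measurable_def space_point_measure sets_point_measure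
      space_borel_algebra)

text \<open>Among the measurable subsets of \<open>A\<close>, the finite set of the atoms of positive weight in \<open>A\<close>
  has the largest value, so it attains the supremum defining the positive part.  On the right hand
  side \<^const>\<open>ennreal\<close> cuts off the negative weights.  As the image of a point measure on the indices,
  the positive part has finite sums as its values and integrals.\<close>
lemma pos_part_atoms:
  "pos_part (borel_algebra X) (atoms J a z) =
     distr (point_measure J (\<lambda>j. ennreal (a j))) (borel_algebra X) z"
proof -
  let ?M = "borel_algebra X"
  let ?N = "distr (point_measure J (\<lambda>j. ennreal (a j))) ?M z"
  have eq: "(SUP B\<in>{B \<in> sets ?M. B \<subseteq> A}. ennreal (atoms J a z B)) = emeasure ?N A"
    if A: "A \<in> sets ?M" for A
  proof -
    define P where "P = {j \<in> J. z j \<in> A}"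
    define s where "s = (\<Sum>j\<in>P. max 0 (a j))"
    have P: "P \<subseteq> J" "finite P"
      using fin unfolding P_def by auto
    have vim: "z -` A \<inter> J = P"
      unfolding P_def by auto
    have "emeasure ?N A = emeasure (point_measure J (\<lambda>j. ennreal (a j))) P"
      by (subst emeasure_distr[OF measurable_atoms A]) (simp only: space_point_measure vim)
    also have "\<dots> = (\<Sum>j\<in>P. ennreal (a j))"
      using fin P by (simp add: emeasure_point_measure_finite)
    also have "\<dots> = (\<Sum>j\<in>P. ennreal (max 0 (a j)))"
      by (rule sum.cong) (auto simp: max_def ennreal_neg)
    finally have N: "emeasure ?N A = ennreal s"
      by (simp add: s_def)
    have le: "atoms J a z B \<le> s" if "B \<subseteq> A" for B
    proof -
      have "atoms J a z B \<le> (\<Sum>j\<in>J. if z j \<in> A then max 0 (a j) else 0)"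
        unfolding atoms_def using that
        by (intro sum_mono) (auto simp: indicator_def max_def)
      also have "\<dots> = s"
        unfolding s_def P_def by (simp add: sum.inter_filter fin)
      finally show ?thesis .
    qed
    define B where "B = z ` {j \<in> P. 0 < a j}"
    have B: "B \<in> sets ?M" "B \<subseteq> A"
      unfolding B_def P_def by (auto intro!: sets_subset_atoms)
    have zB: "z j \<in> B \<longleftrightarrow> z j \<in> A \<and> 0 < a j" if "j \<in> J" for j
      using that inj P unfolding B_def P_def inj_on_def by blast
    have "atoms J a z B = (\<Sum>j\<in>J. if z j \<in> A then max 0 (a j) else 0)"
      unfolding atoms_def by (rule sum.cong) (auto simp: zB indicator_def max_def)
    also have "\<dots> = s"
      unfolding s_def P_def by (simp add: sum.inter_filter fin)
    finally have Bs: "atoms J a z B = s" .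
    show ?thesis
      unfolding N
    proof (rule antisym)
      show "(SUP B\<in>{B \<in> sets ?M. B \<subseteq> A}. ennreal (atoms J a z B)) \<le> ennreal s"
        by (rule SUP_least) (auto intro!: ennreal_leI le)
      show "ennreal s \<le> (SUP B\<in>{B \<in> sets ?M. B \<subseteq> A}. ennreal (atoms J a z B))"
        unfolding Bs[symmetric] using B by (intro SUP_upper) auto
    qed
  qed
  have "pos_part ?M (atoms J a z) = measure_of (space ?M) (sets ?M) (emeasure ?N)"
    unfolding pos_part_def
  proof (rule measure_of_eq)
    show "sets ?M \<subseteq> Pow (space ?M)"
      by (rule sets.space_closed)
    show "(SUP B\<in>{B \<in> sets ?M. B \<subseteq> A}. ennreal (atoms J a z B)) = emeasure ?N A"
      if "A \<in> sigma_sets (space ?M) (sets ?M)" for A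
      using that by (intro eq) (simp add: sets.sigma_sets_eq)
  qed
  also have "\<dots> = ?N"
    using measure_of_of_measure[of ?N] by simp
  finally show ?thesis .
qed

lemma neg_part_atoms:
  "neg_part (borel_algebra X) (atoms J a z) =
     distr (point_measure J (\<lambda>j. ennreal (- a j))) (borel_algebra X) z"
proof -
  have neg: "(\<lambda>A. - atoms J a z A) = atoms J (\<lambda>j. - a j) z"
    unfolding atoms_def by (simp add: sum_negf fun_eq_iff)
  show ?thesis
    unfolding neg_part_def neg by (rule pos_part_atoms)
qed

lemma measure_pos_part_atoms:
  assumes A: "A \<in> sets (borel_algebra X)"
  shows "measure (distr (point_measure J (\<lambda>j. ennreal (a j))) (borel_algebra X) z) A =
    (\<Sum>j\<in>J. max 0 (a j) * indicator A (z j))"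
proof -
  define P where "P = {j \<in> J. z j \<in> A}"
  have P: "P \<subseteq> J" "finite P"
    using fin unfolding P_def by auto
  have vim: "z -` A \<inter> J = P"
    unfolding P_def by auto
  have "measure (distr (point_measure J (\<lambda>j. ennreal (a j))) (borel_algebra X) z) A =
      measure (point_measure J (\<lambda>j. ennreal (a j))) P"
    by (subst measure_distr[OF measurable_atoms A]) (simp only: space_point_measure vim)
  also have "\<dots> = enn2real (\<Sum>j\<in>P. ennreal (a j))"
    using fin P by (simp add: measure_def emeasure_point_measure_finite)
  also have "(\<Sum>j\<in>P. ennreal (a j)) = (\<Sum>j\<in>P. ennreal (max 0 (a j)))"
    by (rule sum.cong) (auto simp: max_def ennreal_neg)
  also have "enn2real \<dots> = (\<Sum>j\<in>P. max 0 (a j))"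
    by (simp add: sum_nonneg)
  also have "\<dots> = (\<Sum>j\<in>J. max 0 (a j) * indicator A (z j))"
    unfolding P_def sum.inter_filter[OF fin] by (rule sum.cong) (auto simp: indicator_def)
  finally show ?thesis .
qed

lemma variation_atoms:
  assumes "A \<in> sets (borel_algebra X)"
  shows "variation (borel_algebra X) (atoms J a z) A = (\<Sum>j\<in>J. \<bar>a j\<bar> * indicator A (z j))"
  unfolding variation_def pos_part_atoms neg_part_atoms measure_pos_part_atoms[OF assms]
  by (auto simp: max_def simp flip: sum.distrib intro!: sum.cong)

lemma tv_norm_atoms: "tv_norm (borel_algebra X) (atoms J a z) = (\<Sum>j\<in>J. \<bar>a j\<bar>)"
proof -
  have "indicator (topspace X) (z j) = (1::real)" if "j \<in> J" for j
    using that sub by (auto simp: indicator_def)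
  then show ?thesis
    unfolding tv_norm_def
    by (subst variation_atoms) (auto simp flip: space_borel_algebra intro!: sum.cong)
qed

lemma signed_integral_atoms:
  fixes f :: "'a \<Rightarrow> real"
  assumes f: "f \<in> borel_measurable (borel_algebra X)"
  shows "signed_integral (borel_algebra X) (atoms J a z) f = (\<Sum>j\<in>J. a j * f (z j))"
proof -
  have "integral\<^sup>L (distr (point_measure J (\<lambda>j. ennreal (b j))) (borel_algebra X) z) f =
      (\<Sum>j\<in>J. max 0 (b j) * f (z j))" for b :: "'i \<Rightarrow> real"
  proof -
    have "(\<lambda>j. ennreal (b j)) = (\<lambda>j. ennreal (max 0 (b j)))"
      by (auto simp: fun_eq_iff max_def ennreal_neg)
    then show ?thesis
      using fin by (simp add: integral_distr[OF measurable_atoms f]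
          lebesgue_integral_point_measure_finite)
  qed
  then show ?thesis
    unfolding signed_integral_def pos_part_atoms neg_part_atoms
    by (auto simp: max_def simp flip: sum_subtractf intro!: sum.cong)
qed

lemma atoms_singleton:
  assumes "j \<in> J"
  shows "atoms J a z {z j} = a j"
proof -
  have "atoms J a z {z j} = (\<Sum>i\<in>J. if i = j then a i else 0)"
    unfolding atoms_def using assms inj
    by (intro sum.cong) (auto simp: indicator_def inj_on_def)
  then show ?thesis
    using assms fin by simp
qed

lemma signed_measure_atoms: "signed_measure (borel_algebra X) (atoms J a z)"
  unfolding signed_measure_def
proof (intro conjI allI impI)
  show "atoms J a z {} = 0"
    by (simp add: atoms_def)
  fix A :: "nat \<Rightarrow> 'a set" assume A: "disjoint_family A"
  have "(\<lambda>i. indicator (A i) x :: real) sums indicator (\<Union>i. A i) x" for x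
  proof (cases "\<exists>i. x \<in> A i")
    case True
    then obtain i where i: "x \<in> A i" by blast
    then have "x \<in> A k \<longleftrightarrow> k = i" for k
      using A unfolding disjoint_family_on_def by blast
    then have "(\<lambda>i. indicator (A i) x :: real) = (\<lambda>k. if k = i then 1 else 0)"
      by (auto simp: indicator_def fun_eq_iff)
    then show ?thesis
      using i sums_single[of i "\<lambda>_. 1::real"] by (auto simp: indicator_def)
  next
    case False
    then show ?thesis
      by simp
  qed
  then show "(\<lambda>i. atoms J a z (A i)) sums atoms J a z (\<Union>i. A i)"
    unfolding atoms_def by (intro sums_sum sums_mult)
qed

lemma signed_radon_measure_atoms: "signed_radon_measure X (atoms J a z)"
  unfolding signed_radon_measure_def
proof (intro conjI ballI allI impI)
  show "signed_measure (borel_algebra X) (atoms J a z)"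
    by (rule signed_measure_atoms)
  fix A and \<epsilon> :: real
  assume A: "A \<in> sets (borel_algebra X)" and \<epsilon>: "0 < \<epsilon>"
  let ?K = "A \<inter> z ` J"
  have K: "?K \<in> sets (borel_algebra X)"
    by (simp add: sets_subset_atoms)
  have "compactin X ?K"
    using sub fin by (intro finite_imp_compactin) auto
  moreover have "variation (borel_algebra X) (atoms J a z) (A - ?K) = 0"
    using A K by (subst variation_atoms) (auto simp: indicator_def intro!: sum.neutral)
  ultimately show "\<exists>K. compactin X K \<and> K \<in> sets (borel_algebra X) \<and> K \<subseteq> A \<and>
      variation (borel_algebra X) (atoms J a z) (A - K) < \<epsilon>"
    using K \<epsilon> by (intro exI[of _ ?K] conjI) (simp_all only: Int_lower1)
qed

text \<open>Finite sets are closed, so a point outside the set of atoms of nonzero weight has a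
  neighbourhood without such atoms.\<close>
lemma supp_atoms: "supp X (atoms J a z) = z ` {j \<in> J. a j \<noteq> 0}"
proof (intro equalityI subsetI)
  fix x assume x: "x \<in> supp X (atoms J a z)"
  show "x \<in> z ` {j \<in> J. a j \<noteq> 0}"
  proof (rule ccontr)
    assume "x \<notin> z ` {j \<in> J. a j \<noteq> 0}"
    let ?U = "topspace X - z ` {j \<in> J. a j \<noteq> 0}"
    have "closedin X (z ` {j \<in> J. a j \<noteq> 0})"
      using t1 fin sub unfolding t1_space_closedin_finite by (auto simp: image_subset_iff)
    then have U: "openin X ?U"
      by blast
    have "variation (borel_algebra X) (atoms J a z) ?U = 0"
      using U by (subst variation_atoms)
        (auto simp: indicator_def intro!: sum.neutral sets_borel_algebra_openin)
    moreover have "x \<in> ?U"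
      using x \<open>x \<notin> _\<close> by (auto simp: supp_def)
    ultimately show False
      using x U by (auto simp: supp_def)
  qed
next
  fix x assume "x \<in> z ` {j \<in> J. a j \<noteq> 0}"
  then obtain j where j: "j \<in> J" "a j \<noteq> 0" "x = z j"
    by blast
  have "0 < variation (borel_algebra X) (atoms J a z) U" if U: "openin X U" "x \<in> U" for U
    unfolding variation_atoms[OF sets_borel_algebra_openin[OF U(1)]]
    using fin j U by (intro sum_pos2[of J j]) auto
  then show "x \<in> supp X (atoms J a z)"
    using j sub by (auto simp: supp_def)
qed

text \<open>By this criterion everything about the supports below follows from the values at
  singletons.\<close>
lemma supp_atoms_iff: "x \<in> supp X (atoms J a z) \<longleftrightarrow> atoms J a z {x} \<noteq> 0"
proof (cases "x \<in> z ` J")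
  case True
  then obtain j where j: "j \<in> J" "x = z j"
    by blast
  then show ?thesis
    using inj by (auto simp: supp_atoms atoms_singleton inj_on_def)
next
  case False
  then show ?thesis
    by (auto simp: supp_atoms atoms_def indicator_def intro!: sum.neutral)
qed

end

lemma restrict_signed_atoms:
  assumes "finite J"
  shows "restrict_signed (atoms J a z) A = atoms {j \<in> J. z j \<in> A} a z"
proof
  fix B
  show "restrict_signed (atoms J a z) A B = atoms {j \<in> J. z j \<in> A} a z B"
    unfolding restrict_signed_def atoms_def sum.inter_filter[OF assms]
    by (rule sum.cong) (simp_all add: indicator_def)
qed

section \<open>Limit sets of sequences of set functions\<close>

text \<open>Eventual and frequent lower bounds replace the extended-real lower and upper limits: the
  weights below are given by case distinctions on \<open>n\<close>, for which such bounds can be read off.\<close>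

lemma LI_set_iff:
  "x \<in> LI_set X \<mu> \<longleftrightarrow>
     x \<in> topspace X \<and> (\<exists>e>0. \<forall>\<^sub>F n in sequentially. e \<le> \<bar>\<mu> n {x}\<bar>)"
proof -
  have "0 < liminf (\<lambda>n. ereal \<bar>\<mu> n {x}\<bar>) \<longleftrightarrow>
      (\<exists>e>0. \<forall>\<^sub>F n in sequentially. e \<le> \<bar>\<mu> n {x}\<bar>)" (is "?l \<longleftrightarrow> ?r")
  proof
    assume ?l
    then obtain e where e: "0 < ereal e" "ereal e < liminf (\<lambda>n. ereal \<bar>\<mu> n {x}\<bar>)"
      using ereal_dense2 by blast
    then have "\<forall>\<^sub>F n in sequentially. ereal e < ereal \<bar>\<mu> n {x}\<bar>"
      by (intro less_LiminfD)
    then have "\<forall>\<^sub>F n in sequentially. e \<le> \<bar>\<mu> n {x}\<bar>"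
      by eventually_elim simp
    then show ?r
      using e by auto
  next
    assume ?r
    then obtain e where e: "0 < e" "\<forall>\<^sub>F n in sequentially. e \<le> \<bar>\<mu> n {x}\<bar>"
      by blast
    then have "ereal e \<le> liminf (\<lambda>n. ereal \<bar>\<mu> n {x}\<bar>)"
      by (intro Liminf_bounded) simp
    then show ?l
      using e by (metis ereal_less(2) less_le_trans)
  qed
  then show ?thesis
    by (simp add: LI_set_def)
qed

lemma LS_set_iff:
  "x \<in> LS_set X \<mu> \<longleftrightarrow>
     x \<in> topspace X \<and> (\<exists>e>0. \<exists>\<^sub>F n in sequentially. e \<le> \<bar>\<mu> n {x}\<bar>)"
proof -
  have "0 < limsup (\<lambda>n. ereal \<bar>\<mu> n {x}\<bar>) \<longleftrightarrow>
      (\<exists>e>0. \<exists>\<^sub>F n in sequentially. e \<le> \<bar>\<mu> n {x}\<bar>)" (is "?l \<longleftrightarrow> ?r")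
  proof
    assume ?l
    then obtain e where e: "0 < ereal e" "ereal e < limsup (\<lambda>n. ereal \<bar>\<mu> n {x}\<bar>)"
      using ereal_dense2 by blast
    have "\<exists>\<^sub>F n in sequentially. e \<le> \<bar>\<mu> n {x}\<bar>"
    proof (rule ccontr)
      assume "\<not> (\<exists>\<^sub>F n in sequentially. e \<le> \<bar>\<mu> n {x}\<bar>)"
      then have "\<forall>\<^sub>F n in sequentially. ereal \<bar>\<mu> n {x}\<bar> \<le> ereal e"
        unfolding not_frequently by eventually_elim simp
      then have "limsup (\<lambda>n. ereal \<bar>\<mu> n {x}\<bar>) \<le> ereal e"
        by (rule Limsup_bounded)
      then show False
        using e by simp
    qed
    then show ?r
      using e by auto
  next
    assume ?r
    then obtain e where e: "0 < e" "\<exists>\<^sub>F n in sequentially. e \<le> \<bar>\<mu> n {x}\<bar>"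
      by blast
    show ?l
    proof (rule ccontr)
      assume "\<not> ?l"
      then have "limsup (\<lambda>n. ereal \<bar>\<mu> n {x}\<bar>) < ereal e"
        using e by (metis ereal_less(2) le_less_trans linorder_not_less)
      then have "\<forall>\<^sub>F n in sequentially. ereal \<bar>\<mu> n {x}\<bar> < ereal e"
        by (rule Limsup_lessD)
      then have "\<forall>\<^sub>F n in sequentially. \<not> e \<le> \<bar>\<mu> n {x}\<bar>"
        by eventually_elim simp
      then show False
        using e by (simp add: frequently_def)
    qed
  qed
  then show ?thesis
    by (simp add: LS_set_def)
qed

lemma L_set_iff:
  "x \<in> L_set X \<mu> \<longleftrightarrow> x \<in> topspace X \<and> (\<exists>l. l \<noteq> 0 \<and> (\<lambda>n. \<mu> n {x}) \<longlonglongrightarrow> l)"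
  by (simp add: L_set_def)

lemma L_set_subset_LI_set: "L_set X \<mu> \<subseteq> LI_set X \<mu>"
proof
  fix x assume "x \<in> L_set X \<mu>"
  then obtain l where x: "x \<in> topspace X" and l: "l \<noteq> 0" "(\<lambda>n. \<mu> n {x}) \<longlonglongrightarrow> l"
    by (auto simp: L_set_iff)
  have "\<bar>l\<bar> / 2 < \<bar>l\<bar>"
    using l by simp
  with tendsto_rabs[OF l(2)] have "\<forall>\<^sub>F n in sequentially. \<bar>l\<bar> / 2 < \<bar>\<mu> n {x}\<bar>"
    by (rule order_tendstoD(1))
  then have "\<forall>\<^sub>F n in sequentially. \<bar>l\<bar> / 2 \<le> \<bar>\<mu> n {x}\<bar>"
    by eventually_elim simp
  moreover have "0 < \<bar>l\<bar> / 2"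
    using l by simp
  ultimately show "x \<in> LI_set X \<mu>"
    unfolding LI_set_iff using x by blast
qed

lemma LI_set_subset_LS_set: "LI_set X \<mu> \<subseteq> LS_set X \<mu>"
  unfolding LI_set_iff LS_set_iff subset_iff
  using eventually_frequently[OF trivial_limit_sequentially] by blast

lemma not_in_LS_set:
  assumes "\<forall>\<^sub>F n in sequentially. \<mu> n {x} = 0"
  shows "x \<notin> LS_set X \<mu>"
proof
  assume "x \<in> LS_set X \<mu>"
  then obtain e where e: "0 < e" "\<exists>\<^sub>F n in sequentially. e \<le> \<bar>\<mu> n {x}\<bar>"
    by (auto simp: LS_set_iff)
  from e(2) assms have "\<exists>\<^sub>F n in sequentially. e \<le> \<bar>\<mu> n {x}\<bar> \<and> \<mu> n {x} = 0"
    by (rule frequently_eventually_frequently)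
  then show False
    using e(1) by (auto dest!: frequently_ex)
qed

lemma not_in_LI_set:
  assumes "\<exists>\<^sub>F n in sequentially. \<mu> n {x} = 0"
  shows "x \<notin> LI_set X \<mu>"
proof
  assume "x \<in> LI_set X \<mu>"
  then obtain e where e: "0 < e" "\<forall>\<^sub>F n in sequentially. e \<le> \<bar>\<mu> n {x}\<bar>"
    by (auto simp: LI_set_iff)
  from assms e(2) have "\<exists>\<^sub>F n in sequentially. \<mu> n {x} = 0 \<and> e \<le> \<bar>\<mu> n {x}\<bar>"
    by (rule frequently_eventually_frequently)
  then show False
    using e(1) by (auto dest!: frequently_ex)
qed

lemma in_LS_set:
  assumes "x \<in> topspace X" "e \<noteq> 0" "\<exists>\<^sub>F n in sequentially. \<mu> n {x} = e"
  shows "x \<in> LS_set X \<mu>"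
proof -
  have "\<exists>\<^sub>F n in sequentially. \<bar>e\<bar> \<le> \<bar>\<mu> n {x}\<bar>"
    using assms(3) by (rule frequently_elim1) simp
  then show ?thesis
    unfolding LS_set_iff using assms by (intro conjI exI[of _ "\<bar>e\<bar>"]) auto
qed

text \<open>Applied to two different values taken infinitely often, this excludes convergence.\<close>
lemma frequently_eq_imp_limit_eq:
  fixes f :: "nat \<Rightarrow> real"
  assumes "f \<longlonglongrightarrow> l" "\<exists>\<^sub>F n in sequentially. f n = a"
  shows "l = a"
proof (rule ccontr)
  assume "l \<noteq> a"
  then have "\<forall>\<^sub>F n in sequentially. f n \<noteq> a"
    using assms(1) tendsto_imp_eventually_ne by blast
  then show False
    using assms(2) by (simp add: frequently_def)
qed

section \<open>Sequences of sums of short dipoles\<close>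

definition dipoles :: "'i set \<Rightarrow> ('i \<Rightarrow> real) \<Rightarrow> ('i \<Rightarrow> 'a) \<Rightarrow> ('i \<Rightarrow> 'a) \<Rightarrow> 'a set \<Rightarrow> real"
  where "dipoles I c p q A = (\<Sum>k\<in>I. c k * (indicator A (p k) - indicator A (q k)))"

lemma dipoles_eq_atoms:
  assumes "finite I"
  shows "dipoles I c p q = atoms (I <+> I) (case_sum c (\<lambda>k. - c k)) (case_sum p q)"
  unfolding dipoles_def atoms_def sum.Plus[OF assms assms] fun_eq_iff
  by (simp add: algebra_simps sum_subtractf sum_negf)

text \<open>The sum of the weights is \<open>1/2\<close>, as each dipole contributes twice its weight to the total
  variation.  The injectivity conditions and \<open>p_neq_q\<close> prevent any cancellation or merging of
  atoms, so that the weights are the values of the measures at singletons.\<close>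
locale dipole_sequence =
  fixes S :: "'a::metric_space set" and I :: "nat \<Rightarrow> 'i set" and c :: "nat \<Rightarrow> 'i \<Rightarrow> real"
    and p q :: "nat \<Rightarrow> 'i \<Rightarrow> 'a" and \<epsilon> :: "nat \<Rightarrow> real"
  assumes compact: "compact S"
    and finite_index: "finite (I n)"
    and nonneg: "k \<in> I n \<Longrightarrow> 0 \<le> c n k"
    and sum_half: "(\<Sum>k\<in>I n. c n k) = 1/2"
    and p_in: "k \<in> I n \<Longrightarrow> p n k \<in> S" and q_in: "k \<in> I n \<Longrightarrow> q n k \<in> S"
    and p_inj: "inj_on (p n) (I n)" and q_inj: "inj_on (q n) (I n)"
    and p_neq_q: "k \<in> I n \<Longrightarrow> i \<in> I n \<Longrightarrow> p n k \<noteq> q n i"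
    and short: "k \<in> I n \<Longrightarrow> dist (p n k) (q n k) \<le> \<epsilon> n"
    and \<epsilon>_lim: "\<epsilon> \<longlonglongrightarrow> 0"
begin

definition \<mu> :: "nat \<Rightarrow> 'a set \<Rightarrow> real"
  where "\<mu> n = dipoles (I n) (c n) (p n) (q n)"

abbreviation "J n \<equiv> I n <+> I n"
abbreviation "a n \<equiv> case_sum (c n) (\<lambda>k. - c n k)"
abbreviation "z n \<equiv> case_sum (p n) (q n)"

lemma \<mu>_eq_atoms: "\<mu> n = atoms (J n) (a n) (z n)"
  unfolding \<mu>_def by (rule dipoles_eq_atoms) (rule finite_index)

lemma t1: "t1_space (top_of_set S)"
  by (intro Hausdorff_imp_t1_space Hausdorff_space_subtopology Hausdorff_space_euclidean)

lemma finite_J: "finite (J n)"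
  by (simp add: finite_index)

lemma inj_z: "inj_on (z n) (J n)"
proof (rule inj_onI)
  fix i j assume "i \<in> J n" "j \<in> J n" "z n i = z n j"
  then show "i = j"
    using p_neq_q[of _ n] p_inj[of n] q_inj[of n] by (fastforce simp: inj_on_def)
qed

lemma z_in: "z n ` J n \<subseteq> topspace (top_of_set S)"
  using p_in q_in by auto

lemma \<mu>_p: "k \<in> I n \<Longrightarrow> \<mu> n {p n k} = c n k"
  using atoms_singleton[OF t1 finite_J inj_z z_in, of "Inl k" n "a n"]
  by (simp add: \<mu>_eq_atoms InlI)

lemma \<mu>_q: "k \<in> I n \<Longrightarrow> \<mu> n {q n k} = - c n k"
  using atoms_singleton[OF t1 finite_J inj_z z_in, of "Inr k" n "a n"]
  by (simp add: \<mu>_eq_atoms InrI)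

lemma \<mu>_other: "x \<notin> p n ` I n \<Longrightarrow> x \<notin> q n ` I n \<Longrightarrow> \<mu> n {x} = 0"
  unfolding \<mu>_def dipoles_def by (rule sum.neutral) (auto simp: indicator_def)

lemma S_set_\<mu>: "x \<in> S_set (top_of_set S) \<mu> \<longleftrightarrow> (\<exists>n. \<mu> n {x} \<noteq> 0)"
  unfolding S_set_def \<mu>_eq_atoms using supp_atoms_iff[OF t1 finite_J inj_z z_in] by blast

lemma LS_set_subset_S_set: "LS_set (top_of_set S) \<mu> \<subseteq> S_set (top_of_set S) \<mu>"
proof
  fix x assume "x \<in> LS_set (top_of_set S) \<mu>"
  then have "\<not> (\<forall>\<^sub>F n in sequentially. \<mu> n {x} = 0)"
    using not_in_LS_set[of \<mu> x "top_of_set S"] by blast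
  then have "\<not> (\<forall>n. \<mu> n {x} = 0)"
    by (auto dest: not_eventuallyD)
  then show "x \<in> S_set (top_of_set S) \<mu>"
    by (simp add: S_set_\<mu>)
qed

text \<open>With \<open>A = UNIV\<close> this also yields the norm of \<open>\<mu> n\<close> itself.\<close>
lemma tv_norm_restrict_\<mu>:
  "tv_norm (borel_algebra (top_of_set S)) (restrict_signed (\<mu> n) A) =
     (\<Sum>k\<in>I n. c n k * (indicator A (p n k) + indicator A (q n k)))"
proof -
  let ?J = "{j \<in> J n. z n j \<in> A}"
  have inj: "inj_on (z n) ?J"
    using inj_z by (rule inj_on_subset) auto
  have "tv_norm (borel_algebra (top_of_set S)) (restrict_signed (\<mu> n) A) = (\<Sum>j\<in>?J. \<bar>a n j\<bar>)"
    unfolding \<mu>_eq_atoms restrict_signed_atoms[OF finite_J]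
    using z_in[of n] finite_J[of n] by (intro tv_norm_atoms t1 inj) auto
  also have "\<dots> = (\<Sum>j\<in>J n. if z n j \<in> A then \<bar>a n j\<bar> else 0)"
    using finite_J by (rule sum.inter_filter)
  also have "\<dots> = (\<Sum>k\<in>I n. c n k * indicator A (p n k)) + (\<Sum>k\<in>I n. c n k * indicator A (q n k))"
    unfolding sum.Plus[OF finite_index finite_index]
    by (intro arg_cong2[where f = "(+)"] sum.cong)
      (auto simp: nonneg indicator_def)
  finally show ?thesis
    by (simp add: distrib_left sum.distrib)
qed

text \<open>The integral of \<open>f\<close> against \<open>\<mu> n\<close> is half a weighted average of the increments of \<open>f\<close> along the
  dipoles.  Their lengths tend to \<open>0\<close>, so the uniform continuity of \<open>f\<close> makes it tend to \<open>0\<close>.\<close>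
theorem fsJN_sequence_\<mu>: "fsJN_sequence (top_of_set S) \<mu>"
  unfolding fsJN_sequence_def
proof (intro conjI allI impI)
  let ?M = "borel_algebra (top_of_set S)"
  show "compact_space (top_of_set S)"
    using compact by (simp add: compact_space_subtopology)
  show "Hausdorff_space (top_of_set S)"
    by (intro Hausdorff_space_subtopology Hausdorff_space_euclidean)
  fix n
  show "signed_radon_measure (top_of_set S) (\<mu> n)"
    unfolding \<mu>_eq_atoms by (rule signed_radon_measure_atoms[OF t1 finite_J inj_z z_in])
  show "finitely_supported (top_of_set S) (\<mu> n)"
    unfolding finitely_supported_def \<mu>_eq_atoms supp_atoms[OF t1 finite_J inj_z z_in]
    using finite_J[of n] by simp
  have "restrict_signed (\<mu> n) UNIV = \<mu> n"
    by (simp add: restrict_signed_def fun_eq_iff)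
  then show "tv_norm ?M (\<mu> n) = 1"
    using tv_norm_restrict_\<mu>[of n UNIV] sum_half[of n]
    by (simp flip: sum_distrib_right)
next
  let ?M = "borel_algebra (top_of_set S)"
  fix f :: "'a \<Rightarrow> real" assume f: "continuous_map (top_of_set S) euclideanreal f"
  have int: "signed_integral ?M (\<mu> n) f = (\<Sum>k\<in>I n. c n k * (f (p n k) - f (q n k)))" for n
    unfolding \<mu>_eq_atoms
      signed_integral_atoms[OF t1 finite_J inj_z z_in continuous_map_imp_borel_measurable[OF f]]
      sum.Plus[OF finite_index finite_index]
    by (simp add: algebra_simps sum_subtractf sum_negf)
  have "continuous_on S f"
    using f by simp
  then have unif: "uniformly_continuous_on S f"
    using compact by (rule compact_uniformly_continuous)
  show "(\<lambda>n. signed_integral ?M (\<mu> n) f) \<longlonglongrightarrow> 0"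
  proof (rule LIMSEQ_I)
    fix e :: real assume e: "0 < e"
    then obtain d where d: "0 < d"
      and ud: "\<And>x y. x \<in> S \<Longrightarrow> y \<in> S \<Longrightarrow> dist y x < d \<Longrightarrow> dist (f y) (f x) < e"
      using unif unfolding uniformly_continuous_on_def by metis
    obtain N where N: "\<And>n. N \<le> n \<Longrightarrow> \<epsilon> n < d"
      using order_tendstoD(2)[OF \<epsilon>_lim d] unfolding eventually_sequentially by blast
    have "norm (signed_integral ?M (\<mu> n) f - 0) < e" if "N \<le> n" for n
    proof -
      have "\<bar>\<Sum>k\<in>I n. c n k * (f (p n k) - f (q n k))\<bar> \<le> (\<Sum>k\<in>I n. c n k * e)"
      proof (rule order_trans[OF sum_abs sum_mono])
        fix k assume k: "k \<in> I n"
        then have "dist (f (p n k)) (f (q n k)) < e"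
          using short[OF k] N[OF that] by (intro ud p_in q_in) auto
        then show "\<bar>c n k * (f (p n k) - f (q n k))\<bar> \<le> c n k * e"
          using nonneg[OF k] by (simp add: abs_mult dist_real_def mult_left_mono)
      qed
      also have "\<dots> = e / 2"
        using sum_half[of n] by (simp flip: sum_distrib_right)
      finally show ?thesis
        using e by (simp add: int)
    qed
    then show "\<exists>no. \<forall>n\<ge>no. norm (signed_integral ?M (\<mu> n) f - 0) < e"
      by blast
  qed
qed

text \<open>If the height \<open>h\<close> of the ends is bounded by \<open>\<epsilon> n\<close>, then the atoms sink below every positive
  level, and a point of positive height is eventually not an end of any dipole.\<close>
lemma LS_set_subset_height_le_0:
  fixes h :: "'a \<Rightarrow> real"
  assumes B: "\<And>n k. k \<in> I n \<Longrightarrow> p n k \<in> B" "\<And>n k. k \<in> I n \<Longrightarrow> q n k \<in> B"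
    and h: "\<And>n k. k \<in> I n \<Longrightarrow> h (p n k) \<le> \<epsilon> n" "\<And>n k. k \<in> I n \<Longrightarrow> h (q n k) \<le> \<epsilon> n"
  shows "LS_set (top_of_set S) \<mu> \<subseteq> {x \<in> B. h x \<le> 0}"
proof
  fix x assume x: "x \<in> LS_set (top_of_set S) \<mu>"
  have "x \<in> B"
  proof (rule ccontr)
    assume "x \<notin> B"
    then have "\<mu> n {x} = 0" for n
      using B[of _ n] by (intro \<mu>_other) auto
    then show False
      using x not_in_LS_set[of \<mu> x "top_of_set S"] by simp
  qed
  moreover have "\<not> 0 < h x"
  proof
    assume "0 < h x"
    with \<epsilon>_lim have "\<forall>\<^sub>F n in sequentially. \<epsilon> n < h x"
      by (rule order_tendstoD(2))
    then have "\<forall>\<^sub>F n in sequentially. \<mu> n {x} = 0"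
    proof eventually_elim
      case (elim n)
      then have "x \<notin> p n ` I n" "x \<notin> q n ` I n"
        using h[of _ n] by force+
      then show ?case
        by (rule \<mu>_other)
    qed
    then show False
      using x not_in_LS_set[of \<mu> x "top_of_set S"] by simp
  qed
  ultimately show "x \<in> {x \<in> B. h x \<le> 0}"
    by simp
qed

end

section \<open>Weights converging to a geometric sequence\<close>

text \<open>The last index \<open>k = n\<close> receives what the first \<open>n\<close> terms \<open>\<beta> / 4, \<beta> / 8, \<dots>\<close> leave of the
  total \<open>1/2\<close>.  Each fixed index is eventually below \<open>n\<close>, so its weight stabilises, and the stable
  weights sum to \<open>\<beta> / 2\<close>; the mass \<open>(1 - \<beta>) / 2\<close> escapes through the last index.\<close>
definition geometric_weight :: "real \<Rightarrow> nat \<Rightarrow> nat \<Rightarrow> real"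
  where "geometric_weight \<beta> n k =
    (if k < n then \<beta> / 2 ^ (k + 2) else 1/2 - \<beta> * (1/2 - 1 / 2 ^ (n + 1)))"

lemma sum_geometric: "(\<Sum>k<n. \<beta> / 2 ^ (k + 2)) = \<beta> * (1/2 - 1 / 2 ^ (n + 1) :: real)"
  by (induction n) (simp_all add: field_simps)

lemma sum_geometric_weight: "(\<Sum>k\<le>n. geometric_weight \<beta> n k) = 1/2"
proof -
  have "(\<Sum>k<n. geometric_weight \<beta> n k) = (\<Sum>k<n. \<beta> / 2 ^ (k + 2))"
    by (rule sum.cong) (auto simp: geometric_weight_def)
  then show ?thesis
    unfolding sum_geometric by (simp add: geometric_weight_def flip: lessThan_Suc_atMost)
qed

lemma geometric_weight_nonneg:
  assumes "0 \<le> \<beta>" "\<beta> \<le> 1"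
  shows "0 \<le> geometric_weight \<beta> n k"
proof -
  have "\<beta> * (1/2 - 1 / 2 ^ (n + 1)) \<le> 1 * (1/2)"
    using assms by (intro mult_mono) (auto simp: field_simps)
  then show ?thesis
    using assms by (simp add: geometric_weight_def)
qed

section \<open>Dense-in-itself sets\<close>

lemma dense_in_itself_if_islimpt:
  assumes "A \<subseteq> S" "\<And>x. x \<in> A \<Longrightarrow> x islimpt A"
  shows "dense_in_itself (top_of_set S) A"
  unfolding dense_in_itself_def
proof (intro conjI notI)
  show "A \<subseteq> topspace (top_of_set S)"
    using assms by simp
  assume "\<exists>x\<in>A. openin (subtopology (top_of_set S) A) {x}"
  then obtain x T where x: "x \<in> A" and T: "open T" "{x} = A \<inter> T"
    using assms(1) by (auto simp: subtopology_subtopology Int_absorb1 openin_open)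
  then show False
    using assms(2)[OF x] unfolding islimpt_def by blast
qed

lemma islimpt_Times_singleton:
  fixes x :: "'a::metric_space" and y :: "'b::metric_space"
  assumes "x islimpt D"
  shows "(x, y) islimpt (D \<times> {y})"
  using assms unfolding islimpt_approachable by (force simp: dist_Pair_Pair)

lemma rational_islimpt:
  assumes "x \<in> {0..1} \<inter> \<rat>"
  shows "x islimpt ({0..1} \<inter> \<rat> :: real set)"
  unfolding islimpt_approachable
proof (intro allI impI)
  fix e :: real assume e: "0 < e"
  \<comment> \<open>the approximation comes from the right in the left half of the unit interval, and from the
    left in the right half, so as to stay in the unit interval\<close>
  define l where "l = (if x \<le> 1/2 then x else max (x - e) 0)"
  define u where "u = (if x \<le> 1/2 then min (x + e) 1 else x)"
  have "l < u"
    using e assms unfolding l_def u_def by auto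
  then obtain y where y: "y \<in> \<rat>" "l < y" "y < u"
    using Rats_dense_in_real by blast
  then have "y \<in> {0..1} \<inter> \<rat>" "y \<noteq> x" "dist y x < e"
    using assms unfolding l_def u_def dist_real_def by (auto split: if_splits)
  then show "\<exists>y\<in>{0..1} \<inter> \<rat>. y \<noteq> x \<and> dist y x < e"
    by blast
qed

lemma dyadic_islimpt:
  assumes "x \<in> {real k / 2 ^ (n + 1) |k n :: nat. k < 2 ^ (n + 1)}"
  shows "x islimpt {real k / 2 ^ (n + 1) |k n :: nat. k < 2 ^ (n + 1)}"
  unfolding islimpt_approachable
proof (intro allI impI)
  fix e :: real assume e: "0 < e"
  obtain k n :: nat where k: "k < 2 ^ (n + 1)" and x: "x = real k / 2 ^ (n + 1)"
    using assms by blast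
  obtain m where m: "(1/2) ^ m < e"
    using real_arch_pow_inv[OF e, of "1/2"] by auto
  \<comment> \<open>the right neighbour of \<open>x\<close> on level \<open>n + m + 2\<close>; the level is chosen above \<open>n + 1\<close> so that the
    neighbour stays below \<open>1\<close>\<close>
  define j where "j = k * 2 ^ (m + 1) + 1"
  have "(k + 1) * 2 ^ (m + 1) \<le> 2 ^ (n + 1) * 2 ^ (m + 1)"
    using k by (intro mult_right_mono) auto
  moreover have "1 < (2::nat) ^ (m + 1)"
    by (rule one_less_power) auto
  ultimately have j: "j < 2 ^ (n + m + 1 + 1)"
    unfolding j_def by (simp add: power_add algebra_simps)
  have eq: "real j / 2 ^ (n + m + 1 + 1) = x + (1/2) ^ (n + m + 2)"
    unfolding j_def x by (simp add: power_add field_simps)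
  have "(1/2 :: real) ^ (n + m + 2) \<le> (1/2) ^ m"
    by (rule power_decreasing) auto
  then have "dist (real j / 2 ^ (n + m + 1 + 1)) x < e"
    unfolding eq dist_real_def using m by simp
  moreover have "real j / 2 ^ (n + m + 1 + 1) \<noteq> x"
    unfolding eq by simp
  ultimately show "\<exists>y\<in>{real k / 2 ^ (n + 1) |k n :: nat. k < 2 ^ (n + 1)}. y \<noteq> x \<and> dist y x < e"
    using j by blast
qed

lemma countable_rational_interval: "countable ({0..1} \<inter> \<rat> :: real set)"
  by (rule countable_subset[OF _ countable_rat]) auto

lemma infinite_rational_interval: "infinite ({0..1} \<inter> \<rat> :: real set)"
  using rational_islimpt[of 0] islimpt_finite[of "{0..1} \<inter> \<rat> :: real set" 0] by auto

lemma rational_enumeration: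
  obtains r :: "nat \<Rightarrow> real" where "range r = {0..1} \<inter> \<rat>" "inj r"
  using bij_betw_from_nat_into[OF countable_rational_interval infinite_rational_interval]
  by (auto simp: bij_betw_def)

section \<open>Vertical dipoles\<close>

lemma inverse_Suc_lim: "(\<lambda>n. 1 / real (n + 1)) \<longlonglongrightarrow> 0"
  using LIMSEQ_inverse_real_of_nat by (simp add: inverse_eq_divide add.commute)

lemma dist_vertical: "dist (x :: 'a::metric_space, s) (x, t) = \<bar>s - t :: real\<bar>"
  by (simp add: dist_Pair_Pair dist_real_def)

lemma unit_square_topspace: "topspace unit_square = {0..1} \<times> {0..1}"
  by (simp add: unit_square_def)

text \<open>Three dipoles stand above \<open>0\<close>, \<open>1/2\<close> and \<open>1\<close>.  Their weights alternate between
  \<open>1/6, 1/6, 1/6\<close> and \<open>0, 1/6, 1/3\<close>, which both sum to \<open>1/2\<close>.  The weight at \<open>1/2\<close> converges, the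
  weight at \<open>1\<close> oscillates away from \<open>0\<close>, the weight at \<open>0\<close> keeps returning to \<open>0\<close>, and the upper
  ends occur in the support but move away.\<close>
lemma fsJN_strict_inclusions:
  "\<exists>\<mu>. fsJN_sequence unit_square \<mu> \<and>
    {} \<noteq> L_set unit_square \<mu> \<and> L_set unit_square \<mu> \<subset> LI_set unit_square \<mu> \<and>
    LI_set unit_square \<mu> \<subset> LS_set unit_square \<mu> \<and> LS_set unit_square \<mu> \<subset> S_set unit_square \<mu>"
proof -
  define c :: "nat \<Rightarrow> nat \<Rightarrow> real" where "c n k = (if even n then 1/6 else real k / 6)" for n k
  define p :: "nat \<Rightarrow> nat \<Rightarrow> real \<times> real" where "p n k = (real k / 2, 0)" for n k
  define q :: "nat \<Rightarrow> nat \<Rightarrow> real \<times> real" where "q n k = (real k / 2, 1 / real (n + 1))" for n k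
  interpret D: dipole_sequence "{0..1} \<times> {0..1}" "\<lambda>_. {..2}" c p q "\<lambda>n. 1 / real (n + 1)"
    by unfold_locales
      (auto simp: c_def p_def q_def compact_Times dist_vertical inj_on_def numeral_2_eq_2
        inverse_Suc_lim[simplified])
  have val: "D.\<mu> n {(real k / 2, 0)} = c n k" if "k \<le> 2" for n k
    using D.\<mu>_p[of k n] that by (simp add: p_def)
  have top: "(real k / 2, 0) \<in> topspace unit_square" if "k \<le> 2" for k
    using that by (auto simp: unit_square_topspace)
  have even: "\<exists>\<^sub>F n in sequentially. even n" and odd: "\<exists>\<^sub>F n in sequentially. odd n"
    unfolding frequently_sequentially
    by (metis dvd_triv_left le_add1 mult_2) (metis even_Suc le_SucI order_refl)
  have fE: "\<exists>\<^sub>F n in sequentially. D.\<mu> n {(real k / 2, 0)} = 1/6" if "k \<le> 2" for k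
    using even by (rule frequently_elim1) (simp add: val[OF that] c_def)
  have fO: "\<exists>\<^sub>F n in sequentially. D.\<mu> n {(real k / 2, 0)} = real k / 6" if "k \<le> 2" for k
    using odd by (rule frequently_elim1) (simp add: val[OF that] c_def)
  have L: "(real 1 / 2, 0) \<in> L_set unit_square D.\<mu>"
  proof -
    have "D.\<mu> n {(real 1 / 2, 0)} = 1/6" for n
      by (subst val) (simp_all add: c_def)
    then have "(\<lambda>n. D.\<mu> n {(real 1 / 2, 0)}) \<longlonglongrightarrow> 1/6"
      by (simp only: tendsto_const)
    then show ?thesis
      unfolding L_set_iff using top[of 1] by (intro conjI exI[of _ "1/6"]) simp_all
  qed
  have LI: "(real 2 / 2, 0) \<in> LI_set unit_square D.\<mu>"
  proof -
    have "1/6 \<le> \<bar>D.\<mu> n {(real 2 / 2, 0)}\<bar>" for n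
      by (subst val) (simp_all add: c_def)
    then show ?thesis
      unfolding LI_set_iff using top[of 2] by (intro conjI exI[of _ "1/6"]) simp_all
  qed
  have notL: "(real 2 / 2, 0) \<notin> L_set unit_square D.\<mu>"
  proof
    assume "(real 2 / 2, 0) \<in> L_set unit_square D.\<mu>"
    then obtain l where l: "(\<lambda>n. D.\<mu> n {(real 2 / 2, 0)}) \<longlonglongrightarrow> l"
      unfolding L_set_iff by blast
    have "l = 1/6" "l = real 2 / 6"
      using frequently_eq_imp_limit_eq[OF l fE] frequently_eq_imp_limit_eq[OF l fO] by simp_all
    then show False
      by simp
  qed
  have LS: "(real 0 / 2, 0) \<in> LS_set unit_square D.\<mu>"
    using top[of 0] fE[of 0] by (intro in_LS_set[of _ _ "1/6"]) auto
  have notLI: "(real 0 / 2, 0) \<notin> LI_set unit_square D.\<mu>"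
    using fO[of 0] by (intro not_in_LI_set) simp
  have S: "q 0 0 \<in> S_set unit_square D.\<mu>"
    unfolding unit_square_def D.S_set_\<mu> using D.\<mu>_q[of 0 0] by (auto simp: c_def intro!: exI[of _ 0])
  have notLS: "q 0 0 \<notin> LS_set unit_square D.\<mu>"
  proof -
    have "LS_set unit_square D.\<mu> \<subseteq> {x \<in> UNIV. snd x \<le> 0}"
      unfolding unit_square_def
      by (rule D.LS_set_subset_height_le_0) (auto simp: p_def q_def)
    then show ?thesis
      by (auto simp: q_def)
  qed
  have "LS_set unit_square D.\<mu> \<subseteq> S_set unit_square D.\<mu>"
    unfolding unit_square_def by (rule D.LS_set_subset_S_set)
  moreover have "fsJN_sequence unit_square D.\<mu>"
    unfolding unit_square_def by (rule D.fsJN_sequence_\<mu>)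
  moreover note L_set_subset_LI_set[of unit_square D.\<mu>] LI_set_subset_LS_set[of unit_square D.\<mu>]
  ultimately show ?thesis
    using L LI notL LS notLI S notLS by (intro exI[of _ D.\<mu>]) blast
qed

text \<open>A single dipole of weight \<open>1/2\<close> visits every rational infinitely often.  It is elsewhere
  infinitely often too, hence the lower limits vanish.\<close>
lemma fsJN_recurrent_atoms:
  "\<exists>\<mu>. fsJN_sequence unit_square \<mu> \<and>
    LS_set unit_square \<mu> = ({0..1} \<inter> \<rat>) \<times> {0} \<and>
    LI_set unit_square \<mu> = {} \<and> LS_set unit_square \<mu> \<subset> S_set unit_square \<mu> \<and>
    (\<forall>x \<in> LS_set unit_square \<mu>. (\<forall>n. \<mu> n {x} \<in> {0, 1/2}) \<and>
       limsup (\<lambda>n. ereal (\<mu> n {x})) = ereal (1/2))"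
proof -
  obtain r :: "nat \<Rightarrow> real" where r_range: "range r = {0..1} \<inter> \<rat>" and r_inj: "inj r"
    by (rule rational_enumeration)
  have r_in: "0 \<le> r k" "r k \<le> 1" for k
    using r_range by auto
  \<comment> \<open>a sequence taking every value infinitely often: the second component of the decoded pair
    is free\<close>
  define idx where "idx n = fst (prod_decode n)" for n
  have idx: "\<exists>\<^sub>F n in sequentially. idx n = k" for k
    unfolding frequently_sequentially
  proof
    fix N
    show "\<exists>n\<ge>N. idx n = k"
      by (rule exI[of _ "prod_encode (k, N)"]) (simp add: idx_def le_prod_encode_2)
  qed
  define c :: "nat \<Rightarrow> unit \<Rightarrow> real" where "c n k = 1/2" for n k
  define p :: "nat \<Rightarrow> unit \<Rightarrow> real \<times> real" where "p n k = (r (idx n), 0)" for n k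
  define q :: "nat \<Rightarrow> unit \<Rightarrow> real \<times> real" where "q n k = (r (idx n), 1 / real (n + 1))" for n k
  interpret D: dipole_sequence "{0..1} \<times> {0..1}" "\<lambda>_. UNIV" c p q "\<lambda>n. 1 / real (n + 1)"
    by unfold_locales
      (auto simp: c_def p_def q_def compact_Times dist_vertical inj_on_def r_in
        inverse_Suc_lim[simplified] UNIV_unit)
  have val: "D.\<mu> n {(r k, 0)} = (if idx n = k then 1/2 else 0)" for n k
  proof (cases "idx n = k")
    case True
    then show ?thesis
      using D.\<mu>_p[of "()" n] by (simp add: p_def c_def)
  next
    case False
    then have "r k \<noteq> r (idx n)"
      using r_inj by (auto dest: injD)
    then show ?thesis
      using False by (simp add: D.\<mu>_other p_def q_def)
  qed
  have low: "LS_set unit_square D.\<mu> \<subseteq> {x \<in> range r \<times> {0..1}. snd x \<le> 0}"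
    unfolding unit_square_def
    by (rule D.LS_set_subset_height_le_0) (auto simp: p_def q_def)
  then have axis: "LS_set unit_square D.\<mu> \<subseteq> ({0..1} \<inter> \<rat>) \<times> {0}"
    unfolding r_range by auto
  have LS: "LS_set unit_square D.\<mu> = ({0..1} \<inter> \<rat>) \<times> {0}"
  proof (intro equalityI axis subsetI)
    fix x :: "real \<times> real" assume "x \<in> ({0..1} \<inter> \<rat>) \<times> {0}"
    then obtain k where k: "x = (r k, 0)"
      unfolding r_range[symmetric] by auto
    have "\<exists>\<^sub>F n in sequentially. D.\<mu> n {x} = 1/2"
      using idx[of k] by (rule frequently_elim1) (simp add: k val)
    then show "x \<in> LS_set unit_square D.\<mu>"
      by (rule in_LS_set[rotated 2]) (auto simp: k unit_square_topspace r_in)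
  qed
  have rk: "\<exists>k. x = (r k, 0)" if "x \<in> LS_set unit_square D.\<mu>" for x
    using that unfolding LS r_range[symmetric] by auto
  have LI: "LI_set unit_square D.\<mu> = {}"
  proof (rule equals0I)
    fix x assume x: "x \<in> LI_set unit_square D.\<mu>"
    then obtain k where k: "x = (r k, 0)"
      using rk[OF subsetD[OF LI_set_subset_LS_set x]] by blast
    have "\<exists>\<^sub>F n in sequentially. D.\<mu> n {x} = 0"
      using idx[of "Suc k"] by (rule frequently_elim1) (simp add: k val)
    then show False
      using x not_in_LI_set[of D.\<mu> x unit_square] by simp
  qed
  have "q 0 () \<in> S_set unit_square D.\<mu>"
    unfolding unit_square_def D.S_set_\<mu> using D.\<mu>_q[of "()" 0]
    by (auto simp: c_def intro!: exI[of _ 0])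
  moreover have "q 0 () \<notin> LS_set unit_square D.\<mu>"
    using low by (auto simp: q_def)
  moreover have "LS_set unit_square D.\<mu> \<subseteq> S_set unit_square D.\<mu>"
    unfolding unit_square_def by (rule D.LS_set_subset_S_set)
  ultimately have S: "LS_set unit_square D.\<mu> \<subset> S_set unit_square D.\<mu>"
    by blast
  have vals: "D.\<mu> n {x} \<in> {0, 1/2}" if "x \<in> LS_set unit_square D.\<mu>" for x n
    using rk[OF that] by (auto simp: val)
  have lims: "limsup (\<lambda>n. ereal (D.\<mu> n {x})) = ereal (1/2)" if x: "x \<in> LS_set unit_square D.\<mu>" for x
  proof (rule antisym)
    have "D.\<mu> n {x} \<le> 1/2" for n
      using vals[OF x, of n] by auto
    then show "limsup (\<lambda>n. ereal (D.\<mu> n {x})) \<le> ereal (1/2)"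
      by (intro Limsup_bounded) simp
    obtain k where k: "x = (r k, 0)"
      using rk[OF x] by blast
    show "ereal (1/2) \<le> limsup (\<lambda>n. ereal (D.\<mu> n {x}))"
    proof (rule ccontr)
      assume "\<not> ?thesis"
      then have "\<forall>\<^sub>F n in sequentially. ereal (D.\<mu> n {x}) < ereal (1/2)"
        by (intro Limsup_lessD) simp
      then have "\<forall>\<^sub>F n in sequentially. idx n \<noteq> k"
        by eventually_elim (auto simp: k val)
      then show False
        using idx[of k] by (simp add: frequently_def)
    qed
  qed
  have "fsJN_sequence unit_square D.\<mu>"
    unfolding unit_square_def by (rule D.fsJN_sequence_\<mu>)
  then show ?thesis
    by (intro exI[of _ D.\<mu>] conjI ballI allI LS LI S vals lims)
qed

text \<open>The dipole over the \<open>k\<close>-th rational has its lower end on the axis if \<open>k < n\<close>, and then its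
  weight is the stable one.  The dipole with the excess weight, at \<open>k = n\<close>, is lifted off the axis
  altogether, so that the axis carries exactly the stable part of the mass.\<close>
lemma fsJN_prescribed_limit_mass:
  assumes "0 < \<beta>" "\<beta> \<le> 1"
  shows "\<exists>\<mu>. fsJN_sequence unit_square \<mu> \<and>
    L_set unit_square \<mu> = ({0..1} \<inter> \<rat>) \<times> {0} \<and>
    LS_set unit_square \<mu> \<subseteq> L_set unit_square \<mu> \<and> LS_set unit_square \<mu> \<subset> S_set unit_square \<mu> \<and>
    ((\<lambda>x. lim (\<lambda>n. \<mu> n {x})) has_sum (\<beta> / 2)) (L_set unit_square \<mu>) \<and>
    (\<lambda>m. tv_norm (borel_algebra unit_square)
       (restrict_signed (\<mu> m) (L_set unit_square \<mu>))) \<longlonglongrightarrow> \<beta> / 2"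
proof -
  obtain r :: "nat \<Rightarrow> real" where r_range: "range r = {0..1} \<inter> \<rat>" and r_inj: "inj r"
    by (rule rational_enumeration)
  have r_in: "0 \<le> r k" "r k \<le> 1" for k
    using r_range by auto
  \<comment> \<open>the raised lower ends, at \<open>1 / (n + 2)\<close>, stay strictly below the upper ends\<close>
  define h where "h n k = (if k < n then 0 else 1 / real (n + 2))" for n k :: nat
  have h: "0 \<le> h n k" "h n k < 1 / real (n + 1)" for n k
    by (auto simp: h_def field_simps)
  define c where "c = geometric_weight \<beta>"
  define p where "p n k = (r k, h n k)" for n k
  define q where "q n k = (r k, 1 / real (n + 1))" for n k
  have h1: "h n k \<le> 1" for n k
    by (simp add: h_def)
  interpret D: dipole_sequence "{0..1} \<times> {0..1}" "\<lambda>n. {..n}" c p q "\<lambda>n. 1 / real (n + 1)"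
  proof
    fix n k i
    show "p n k \<in> {0..1} \<times> {0..1}"
      using h[of n k] h1[of n k] r_in[of k] by (auto simp: p_def)
    show "q n k \<in> {0..1} \<times> {0..1}"
      using r_in[of k] by (auto simp: q_def)
    show "p n k \<noteq> q n i"
      using h[of n k] by (simp add: p_def q_def)
    show "dist (p n k) (q n k) \<le> 1 / real (n + 1)"
      using h[of n k] by (simp add: p_def q_def dist_vertical)
    show "(\<lambda>n. 1 / real (n + 1)) \<longlonglongrightarrow> 0"
      by (rule inverse_Suc_lim)
  qed (use r_inj assms in \<open>auto simp: c_def p_def q_def compact_Times inj_on_def
        sum_geometric_weight geometric_weight_nonneg\<close>)
  have low: "LS_set unit_square D.\<mu> \<subseteq> {x \<in> range r \<times> {0..1}. snd x \<le> 0}"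
    unfolding unit_square_def
    by (rule D.LS_set_subset_height_le_0) (use h h1 in \<open>auto simp: p_def q_def less_imp_le\<close>)
  then have axis: "LS_set unit_square D.\<mu> \<subseteq> ({0..1} \<inter> \<rat>) \<times> {0}"
    unfolding r_range by auto
  have lim: "(\<lambda>n. D.\<mu> n {(r k, 0)}) \<longlonglongrightarrow> \<beta> / 2 ^ (k + 2)" for k
  proof (rule tendsto_eventually)
    show "\<forall>\<^sub>F n in sequentially. D.\<mu> n {(r k, 0)} = \<beta> / 2 ^ (k + 2)"
      using eventually_gt_at_top[of k]
    proof eventually_elim
      case (elim n)
      then show ?case
        using D.\<mu>_p[of k n] by (simp add: p_def h_def c_def geometric_weight_def)
    qed
  qed
  have L': "({0..1} \<inter> \<rat>) \<times> {0} \<subseteq> L_set unit_square D.\<mu>"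
  proof
    fix x :: "real \<times> real" assume "x \<in> ({0..1} \<inter> \<rat>) \<times> {0}"
    then obtain k where k: "x = (r k, 0)"
      unfolding r_range[symmetric] by auto
    show "x \<in> L_set unit_square D.\<mu>"
      unfolding L_set_iff k using lim[of k] assms
      by (intro conjI exI[of _ "\<beta> / 2 ^ (k + 2)"]) (auto simp: unit_square_topspace r_in)
  qed
  with axis have L: "L_set unit_square D.\<mu> = ({0..1} \<inter> \<rat>) \<times> {0}"
    and LSL: "LS_set unit_square D.\<mu> \<subseteq> L_set unit_square D.\<mu>"
    using L_set_subset_LI_set[of unit_square D.\<mu>] LI_set_subset_LS_set[of unit_square D.\<mu>]
    by blast+
  have "c 0 0 \<noteq> 0"
    by (simp add: c_def geometric_weight_def)
  then have "q 0 0 \<in> S_set unit_square D.\<mu>"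
    unfolding unit_square_def D.S_set_\<mu> using D.\<mu>_q[of 0 0]
    by (auto intro!: exI[of _ 0])
  moreover have "q 0 0 \<notin> LS_set unit_square D.\<mu>"
    using low by (auto simp: q_def)
  moreover have "LS_set unit_square D.\<mu> \<subseteq> S_set unit_square D.\<mu>"
    unfolding unit_square_def by (rule D.LS_set_subset_S_set)
  ultimately have S: "LS_set unit_square D.\<mu> \<subset> S_set unit_square D.\<mu>"
    by blast
  have partial: "(\<lambda>n. \<beta> * (1/2 - 1 / 2 ^ (n + 1))) \<longlonglongrightarrow> \<beta> / 2"
  proof -
    have "(\<lambda>n. \<beta> * (1/2 - (1/2) ^ Suc n)) \<longlonglongrightarrow> \<beta> * (1/2 - 0)"
      by (intro tendsto_intros LIMSEQ_Suc LIMSEQ_power_zero) simp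
    then show ?thesis
      by (simp add: power_divide)
  qed
  have sum: "((\<lambda>x. lim (\<lambda>n. D.\<mu> n {x})) has_sum (\<beta> / 2)) (L_set unit_square D.\<mu>)"
  proof -
    have "(\<lambda>k. \<beta> / 2 ^ (k + 2)) sums (\<beta> / 2)"
      unfolding sums_def sum_geometric by (rule partial)
    then have "((\<lambda>k. \<beta> / 2 ^ (k + 2)) has_sum (\<beta> / 2)) UNIV"
      using assms by (intro sums_nonneg_imp_has_sum) auto
    moreover have "((\<lambda>x. lim (\<lambda>n. D.\<mu> n {x})) \<circ> (\<lambda>k. (r k, 0))) = (\<lambda>k. \<beta> / 2 ^ (k + 2))"
      using limI[OF lim] by (simp add: fun_eq_iff)
    moreover have "inj_on (\<lambda>k. (r k, 0::real)) UNIV"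
      using r_inj by (auto simp: inj_on_def)
    moreover have "L_set unit_square D.\<mu> = range (\<lambda>k. (r k, 0))"
      unfolding L r_range[symmetric] by auto
    ultimately show ?thesis
      by (simp add: has_sum_reindex)
  qed
  have "tv_norm (borel_algebra unit_square) (restrict_signed (D.\<mu> m) (L_set unit_square D.\<mu>)) =
      \<beta> * (1/2 - 1 / 2 ^ (m + 1))" for m
  proof -
    have "tv_norm (borel_algebra unit_square) (restrict_signed (D.\<mu> m) (L_set unit_square D.\<mu>)) =
        (\<Sum>k\<le>m. if k < m then \<beta> / 2 ^ (k + 2) else 0)"
      unfolding unit_square_def D.tv_norm_restrict_\<mu>
      unfolding unit_square_def[symmetric] L r_range[symmetric]
      by (rule sum.cong) (auto simp: p_def q_def h_def c_def geometric_weight_def)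
    also have "\<dots> = (\<Sum>k<m. \<beta> / 2 ^ (k + 2))"
      by (simp flip: lessThan_Suc_atMost)
    finally show ?thesis
      unfolding sum_geometric .
  qed
  then have tv: "(\<lambda>m. tv_norm (borel_algebra unit_square)
       (restrict_signed (D.\<mu> m) (L_set unit_square D.\<mu>))) \<longlonglongrightarrow> \<beta> / 2"
    using partial by simp
  have "fsJN_sequence unit_square D.\<mu>"
    unfolding unit_square_def by (rule D.fsJN_sequence_\<mu>)
  then show ?thesis
    using L LSL S sum tv by blast
qed

section \<open>Dipoles inside a dense-in-itself set\<close>

lemma infinite_sets_distinct_representatives:
  assumes "finite I" "\<And>i. i \<in> I \<Longrightarrow> infinite (A i)"
  shows "\<exists>g. inj_on g I \<and> (\<forall>i\<in>I. g i \<in> A i)"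
  using assms
proof (induction I)
  case (insert i F)
  then obtain g where g: "inj_on g F" "\<forall>j\<in>F. g j \<in> A j"
    by auto
  have "infinite (A i - g ` F)"
    using insert by (simp add: Diff_infinite_finite)
  then obtain y where y: "y \<in> A i" "y \<notin> g ` F"
    using infinite_imp_nonempty by blast
  have "inj_on (g(i := y)) (insert i F)"
    using g y insert(2) by (auto simp: inj_on_def)
  moreover have "\<forall>j\<in>insert i F. (g(i := y)) j \<in> A j"
    using g y insert(2) by auto
  ultimately show ?case
    by blast
qed auto

text \<open>Enumerate \<open>D\<close> as \<open>x 0, x 1, \<dots>\<close>.  At stage \<open>n\<close> the points \<open>x k\<close> with \<open>k \<le> n\<close> carry the positive
  mass, and the negative mass sits on distinct points of \<open>D\<close> close to them with indices above \<open>n\<close>.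
  A given point \<open>x k\<close> can be used as a negative end at stages \<open>n < k\<close> only, and afterwards it
  has a positive weight that stabilises at \<open>1 / 2 ^ (k + 2)\<close>.  Since \<open>D\<close> has no isolated points, close
  points with large indices are available in infinite supply.\<close>
lemma fsJN_all_limit_sets_equal:
  fixes S D :: "'a::metric_space set"
  assumes "compact S" "D \<subseteq> S" "countable D" "D \<noteq> {}"
    and limpt: "\<And>x. x \<in> D \<Longrightarrow> x islimpt D"
  shows "\<exists>\<mu>. fsJN_sequence (top_of_set S) \<mu> \<and>
    L_set (top_of_set S) \<mu> = D \<and> LI_set (top_of_set S) \<mu> = D \<and>
    LS_set (top_of_set S) \<mu> = D \<and> S_set (top_of_set S) \<mu> = D \<and>
    (\<forall>m. tv_norm (borel_algebra (top_of_set S)) (restrict_signed (\<mu> m) D) = 1)"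
proof -
  have "infinite D"
    using assms(4) limpt islimpt_finite by blast
  define x where "x = from_nat_into D"
  have "bij_betw x UNIV D"
    unfolding x_def by (rule bij_betw_from_nat_into[OF assms(3) \<open>infinite D\<close>])
  then have x_range: "range x = D" and x_inj: "inj x"
    by (auto simp: bij_betw_def)
  have near: "infinite {j. n < j \<and> dist (x k) (x j) < 1 / real (n + 1)}" for n k
  proof
    assume fin: "finite {j. n < j \<and> dist (x k) (x j) < 1 / real (n + 1)}"
    have "D \<inter> ball (x k) (1 / real (n + 1)) \<subseteq>
        x ` ({j. n < j \<and> dist (x k) (x j) < 1 / real (n + 1)} \<union> {..n})"
      unfolding x_range[symmetric] by (auto simp: not_less)
    then have "finite (D \<inter> ball (x k) (1 / real (n + 1)))"
      by (rule finite_subset) (use fin in simp)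
    moreover have "x k islimpt D"
      using limpt x_range by blast
    ultimately show False
      unfolding islimpt_eq_infinite_ball by simp
  qed
  have "\<exists>g. inj_on g {..n} \<and> (\<forall>k\<in>{..n}. g k \<in> {j. n < j \<and> dist (x k) (x j) < 1 / real (n + 1)})" for n
    by (rule infinite_sets_distinct_representatives) (use near in auto)
  then have "\<exists>g. \<forall>n. inj_on (g n) {..n} \<and>
      (\<forall>k\<in>{..n}. g n k \<in> {j. n < j \<and> dist (x k) (x j) < 1 / real (n + 1)})"
    by (intro choice allI)
  then obtain g where g_inj: "\<And>n. inj_on (g n) {..n}"
    and g: "\<And>n k. k \<le> n \<Longrightarrow> n < g n k \<and> dist (x k) (x (g n k)) < 1 / real (n + 1)"
    by auto
  define p where "p n k = x k" for n k :: nat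
  define q where "q n k = x (g n k)" for n k
  interpret D: dipole_sequence S "\<lambda>n. {..n}" "geometric_weight 1" p q "\<lambda>n. 1 / real (n + 1)"
  proof
    fix n k i
    show "p n k \<in> S" "q n k \<in> S"
      using assms(2) x_range by (auto simp: p_def q_def)
    show "inj_on (p n) {..n}"
      using x_inj by (auto simp: p_def inj_on_def)
    show "inj_on (q n) {..n}"
      using x_inj g_inj[of n] by (auto simp: q_def inj_on_def)
    show "(\<lambda>n. 1 / real (n + 1)) \<longlonglongrightarrow> 0"
      by (rule inverse_Suc_lim)
    assume k: "k \<in> {..n}"
    show "dist (p n k) (q n k) \<le> 1 / real (n + 1)"
      using g[of k n] k by (simp add: p_def q_def)
    assume "i \<in> {..n}"
    then have "k < g n i"
      using k g[of i n] by simp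
    then show "p n k \<noteq> q n i"
      using x_inj by (auto simp: p_def q_def dest: injD)
  qed (simp_all add: assms(1) sum_geometric_weight geometric_weight_nonneg)
  have "(\<lambda>n. D.\<mu> n {x k}) \<longlonglongrightarrow> 1 / 2 ^ (k + 2)" for k
  proof (rule tendsto_eventually)
    show "\<forall>\<^sub>F n in sequentially. D.\<mu> n {x k} = 1 / 2 ^ (k + 2)"
      using eventually_gt_at_top[of k]
    proof eventually_elim
      case (elim n)
      then show ?case
        using D.\<mu>_p[of k n] by (simp add: p_def geometric_weight_def)
    qed
  qed
  moreover have "1 / 2 ^ (k + 2) \<noteq> (0::real)" for k
    by simp
  ultimately have "x k \<in> L_set (top_of_set S) D.\<mu>" for k
    unfolding L_set_iff using assms(2) x_range by (intro conjI exI[of _ "1 / 2 ^ (k + 2)"]) auto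
  then have DL: "D \<subseteq> L_set (top_of_set S) D.\<mu>"
    using x_range by blast
  have SD: "S_set (top_of_set S) D.\<mu> \<subseteq> D"
  proof
    fix y assume "y \<in> S_set (top_of_set S) D.\<mu>"
    then obtain n where "D.\<mu> n {y} \<noteq> 0"
      by (auto simp: D.S_set_\<mu>)
    then have "y \<in> p n ` {..n} \<or> y \<in> q n ` {..n}"
      using D.\<mu>_other by blast
    then show "y \<in> D"
      using x_range by (auto simp: p_def q_def)
  qed
  have tv: "tv_norm (borel_algebra (top_of_set S)) (restrict_signed (D.\<mu> m) D) = 1" for m
  proof -
    have "p m k \<in> D" "q m k \<in> D" for k
      using x_range by (auto simp: p_def q_def)
    then show ?thesis
      using sum_geometric_weight[of 1 m]
      by (simp add: D.tv_norm_restrict_\<mu> flip: sum_distrib_right)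
  qed
  have "L_set (top_of_set S) D.\<mu> = D" "LI_set (top_of_set S) D.\<mu> = D"
    "LS_set (top_of_set S) D.\<mu> = D" "S_set (top_of_set S) D.\<mu> = D"
    using DL SD L_set_subset_LI_set[of "top_of_set S" D.\<mu>]
      LI_set_subset_LS_set[of "top_of_set S" D.\<mu>] D.LS_set_subset_S_set
    by blast+
  then show ?thesis
    using D.fsJN_sequence_\<mu> tv by blast
qed

section \<open>The four sequences\<close>

lemma has_sum_infinity:
  assumes "infinite A" "0 < (e::real)"
  shows "((\<lambda>x. ereal e) has_sum \<infinity>) A"
  unfolding has_sum_def tendsto_PInfty
proof (intro allI)
  fix r :: real
  obtain n :: nat where n: "r < real n * e"
    using assms(2) reals_Archimedean3 by blast
  obtain B where B: "finite B" "card B = n" "B \<subseteq> A"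
    using assms(1) infinite_arbitrarily_large by blast
  have "ereal r < (\<Sum>x\<in>Y. ereal e)" if "finite Y" "B \<subseteq> Y" for Y
  proof -
    have "real n * e \<le> real (card Y) * e"
      using card_mono[OF that] B assms(2) by simp
    then show ?thesis
      using n by simp
  qed
  then show "\<forall>\<^sub>F Y in finite_subsets_at_top A. ereal r < (\<Sum>x\<in>Y. ereal e)"
    unfolding eventually_finite_subsets_at_top using B by blast
qed

theorem proposition4p7:
  fixes \<alpha> :: real
  assumes "\<alpha> \<in> {0<..<1}"
  shows "\<exists>\<mu>1 \<mu>2 \<mu>3 \<mu>4 :: nat \<Rightarrow> (real \<times> real) set \<Rightarrow> real.
    fsJN_sequence unit_square \<mu>1 \<and> fsJN_sequence unit_square \<mu>2 \<and>
    fsJN_sequence unit_square \<mu>3 \<and> fsJN_sequence unit_square \<mu>4 \<and>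
    \<comment> \<open>(1)\<close>
    ({} \<noteq> L_set unit_square \<mu>1 \<and>
     L_set unit_square \<mu>1 \<subset> LI_set unit_square \<mu>1 \<and>
     LI_set unit_square \<mu>1 \<subset> LS_set unit_square \<mu>1 \<and>
     LS_set unit_square \<mu>1 \<subset> S_set unit_square \<mu>1) \<and>
    \<comment> \<open>(2)\<close>
    (LS_set unit_square \<mu>2 = ({0..1} \<inter> \<rat>) \<times> {0} \<and>
     dense_in_itself unit_square (LS_set unit_square \<mu>2)) \<and>
    ({} = L_set unit_square \<mu>2 \<and>
     L_set unit_square \<mu>2 = LI_set unit_square \<mu>2 \<and>
     LI_set unit_square \<mu>2 \<subset> LS_set unit_square \<mu>2 \<and>
     LS_set unit_square \<mu>2 \<subset> S_set unit_square \<mu>2) \<and>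
    (\<forall>x \<in> LS_set unit_square \<mu>2. \<forall>n. \<mu>2 n {x} \<in> {0, 1/2}) \<and>
    ((\<forall>x \<in> LS_set unit_square \<mu>2. limsup (\<lambda>n. ereal (\<mu>2 n {x})) = ereal (1/2)) \<and>
     (\<forall>F. finite F \<longrightarrow> F \<subseteq> LS_set unit_square \<mu>2 \<longrightarrow>
        (\<Sum>x\<in>F. limsup (\<lambda>n. ereal (\<mu>2 n {x}))) = ereal (real (card F) / 2)) \<and>
     ((\<lambda>x. limsup (\<lambda>n. ereal (\<mu>2 n {x}))) has_sum \<infinity>) (LS_set unit_square \<mu>2)) \<and>
    \<comment> \<open>(3)\<close>
    (L_set unit_square \<mu>3 = ({0..1} \<inter> \<rat>) \<times> {0} \<and>
     dense_in_itself unit_square (L_set unit_square \<mu>3)) \<and>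
    ({} \<noteq> L_set unit_square \<mu>3 \<and>
     L_set unit_square \<mu>3 = LI_set unit_square \<mu>3 \<and>
     LI_set unit_square \<mu>3 = LS_set unit_square \<mu>3 \<and>
     LS_set unit_square \<mu>3 \<subset> S_set unit_square \<mu>3) \<and>
    (((\<lambda>x. lim (\<lambda>n. \<mu>3 n {x})) has_sum ((1 - \<alpha>) / 2)) (L_set unit_square \<mu>3) \<and>
     (\<lambda>m. tv_norm (borel_algebra unit_square)
             (restrict_signed (\<mu>3 m) (L_set unit_square \<mu>3))) \<longlonglongrightarrow> (1 - \<alpha>) / 2 \<and>
     (1 - \<alpha>) / 2 \<le> 1/2) \<and>
    \<comment> \<open>(4)\<close>
    L_set unit_square \<mu>4 = {real k / 2 ^ (n + 1) |k n :: nat. k < 2 ^ (n + 1)} \<times> {0} \<and>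
    ({} \<noteq> L_set unit_square \<mu>4 \<and>
     L_set unit_square \<mu>4 = LI_set unit_square \<mu>4 \<and>
     LI_set unit_square \<mu>4 = LS_set unit_square \<mu>4 \<and>
     LS_set unit_square \<mu>4 = S_set unit_square \<mu>4) \<and>
    (\<forall>m. tv_norm (borel_algebra unit_square)
            (restrict_signed (\<mu>4 m) (L_set unit_square \<mu>4)) = 1)"
proof -
  let ?X = unit_square
  let ?Q = "({0..1} \<inter> \<rat>) \<times> {0} :: (real \<times> real) set"
  define Y :: "real set" where "Y = {real k / 2 ^ (n + 1) |k n :: nat. k < 2 ^ (n + 1)}"
  let ?D = "Y \<times> {0} :: (real \<times> real) set"
  have mono: "L_set ?X \<mu> \<subseteq> LI_set ?X \<mu>" "LI_set ?X \<mu> \<subseteq> LS_set ?X \<mu>" for \<mu>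
    by (rule L_set_subset_LI_set LI_set_subset_LS_set)+
  have Q_dense: "dense_in_itself ?X ?Q"
    unfolding unit_square_def
    by (rule dense_in_itself_if_islimpt) (auto intro!: islimpt_Times_singleton rational_islimpt)
  have Q_infinite: "infinite ?Q"
    using infinite_rational_interval finite_cartesian_productD1 by blast
  then have Q_nonempty: "?Q \<noteq> {}"
    by (rule infinite_imp_nonempty)
  obtain \<mu>1 where \<mu>1: "fsJN_sequence ?X \<mu>1"
    "{} \<noteq> L_set ?X \<mu>1" "L_set ?X \<mu>1 \<subset> LI_set ?X \<mu>1"
    "LI_set ?X \<mu>1 \<subset> LS_set ?X \<mu>1" "LS_set ?X \<mu>1 \<subset> S_set ?X \<mu>1"
    using fsJN_strict_inclusions by metis
  obtain \<mu>2 where \<mu>2: "fsJN_sequence ?X \<mu>2" "LS_set ?X \<mu>2 = ?Q" "LI_set ?X \<mu>2 = {}"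
    "LS_set ?X \<mu>2 \<subset> S_set ?X \<mu>2"
    "\<And>x n. x \<in> LS_set ?X \<mu>2 \<Longrightarrow> \<mu>2 n {x} \<in> {0, 1/2}"
    "\<And>x. x \<in> LS_set ?X \<mu>2 \<Longrightarrow> limsup (\<lambda>n. ereal (\<mu>2 n {x})) = ereal (1/2)"
    using fsJN_recurrent_atoms by metis
  have L2: "L_set ?X \<mu>2 = {}"
    using mono(1)[of \<mu>2] \<mu>2(3) by simp
  have finite_sum: "(\<Sum>x\<in>F. limsup (\<lambda>n. ereal (\<mu>2 n {x}))) = ereal (real (card F) / 2)"
    if "F \<subseteq> LS_set ?X \<mu>2" for F
  proof -
    have "(\<Sum>x\<in>F. limsup (\<lambda>n. ereal (\<mu>2 n {x}))) = (\<Sum>x\<in>F. ereal (1/2))"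
      using that by (intro sum.cong refl \<mu>2(6)) blast
    then show ?thesis
      by simp
  qed
  have infinite_sum: "((\<lambda>x. limsup (\<lambda>n. ereal (\<mu>2 n {x}))) has_sum \<infinity>) (LS_set ?X \<mu>2)"
  proof -
    have "infinite (LS_set ?X \<mu>2)"
      using Q_infinite \<mu>2(2) by simp
    then have "((\<lambda>x. ereal (1/2)) has_sum \<infinity>) (LS_set ?X \<mu>2)"
      by (rule has_sum_infinity) simp
    moreover have "((\<lambda>x. limsup (\<lambda>n. ereal (\<mu>2 n {x}))) has_sum \<infinity>) (LS_set ?X \<mu>2) \<longleftrightarrow>
        ((\<lambda>x. ereal (1/2)) has_sum \<infinity>) (LS_set ?X \<mu>2)"
      by (rule has_sum_cong) (rule \<mu>2(6))
    ultimately show ?thesis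
      by blast
  qed
  have weight: "0 < 1 - \<alpha>" "1 - \<alpha> \<le> 1"
    using assms by simp_all
  obtain \<mu>3 where \<mu>3: "fsJN_sequence ?X \<mu>3" "L_set ?X \<mu>3 = ?Q"
    "LS_set ?X \<mu>3 \<subseteq> L_set ?X \<mu>3" "LS_set ?X \<mu>3 \<subset> S_set ?X \<mu>3"
    "((\<lambda>x. lim (\<lambda>n. \<mu>3 n {x})) has_sum ((1 - \<alpha>) / 2)) (L_set ?X \<mu>3)"
    "(\<lambda>m. tv_norm (borel_algebra ?X) (restrict_signed (\<mu>3 m) (L_set ?X \<mu>3)))
       \<longlonglongrightarrow> (1 - \<alpha>) / 2"
    using fsJN_prescribed_limit_mass[of "1 - \<alpha>"] weight by metis
  have eq3: "L_set ?X \<mu>3 = LI_set ?X \<mu>3" "LI_set ?X \<mu>3 = LS_set ?X \<mu>3"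
    using mono[of \<mu>3] \<mu>3(3) by (simp_all add: subset_antisym)
  have D_sub: "?D \<subseteq> {0..1} \<times> {0..1}"
  proof -
    have "real k / 2 ^ (n + 1) \<le> 1" if "k < 2 ^ (n + 1)" for k n
    proof -
      have "real k \<le> real (2 ^ (n + 1))"
        using that by (intro of_nat_mono less_imp_le)
      then show ?thesis
        by (simp add: divide_le_eq)
    qed
    then show ?thesis
      unfolding Y_def by auto
  qed
  have "Y \<subseteq> \<rat>"
    unfolding Y_def by auto
  then have D_countable: "countable ?D"
    using countable_rat by (intro countable_SIGMA) (auto intro: countable_subset)
  have "0 \<in> Y"
    unfolding Y_def by (auto intro!: exI[of _ 0])
  then have D_nonempty: "?D \<noteq> {}"
    by blast
  have D_limpt: "x islimpt ?D" if x: "x \<in> ?D" for x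
  proof -
    from x obtain y where y: "y \<in> Y" "x = (y, 0)"
      by blast
    have "y islimpt Y"
      using y(1) unfolding Y_def by (rule dyadic_islimpt)
    then show ?thesis
      unfolding y(2) by (rule islimpt_Times_singleton)
  qed
  obtain \<mu>4 where \<mu>4: "fsJN_sequence ?X \<mu>4" "L_set ?X \<mu>4 = ?D" "LI_set ?X \<mu>4 = ?D"
    "LS_set ?X \<mu>4 = ?D" "S_set ?X \<mu>4 = ?D"
    "\<And>m. tv_norm (borel_algebra ?X) (restrict_signed (\<mu>4 m) ?D) = 1"
    using fsJN_all_limit_sets_equal[OF compact_Times[OF compact_Icc compact_Icc] D_sub D_countable
        D_nonempty D_limpt]
    unfolding unit_square_def[symmetric] by metis
  then have eq4: "L_set ?X \<mu>4 = LI_set ?X \<mu>4" "LI_set ?X \<mu>4 = LS_set ?X \<mu>4"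
    "LS_set ?X \<mu>4 = S_set ?X \<mu>4"
    by simp_all
  show ?thesis
    unfolding Y_def[symmetric]
  proof (rule exI[of _ \<mu>1], rule exI[of _ \<mu>2], rule exI[of _ \<mu>3], rule exI[of _ \<mu>4], intro conjI)
    show "{} \<noteq> L_set ?X \<mu>3" "{} \<noteq> L_set ?X \<mu>4"
      unfolding \<mu>3(2) \<mu>4(2) by (rule not_sym[OF Q_nonempty] not_sym[OF D_nonempty])+
    show "dense_in_itself ?X (LS_set ?X \<mu>2)" "dense_in_itself ?X (L_set ?X \<mu>3)"
      using Q_dense \<mu>2(2) \<mu>3(2) by simp_all
    show "{} = L_set ?X \<mu>2" "L_set ?X \<mu>2 = LI_set ?X \<mu>2"
      using L2 \<mu>2(3) by simp_all
    show "LI_set ?X \<mu>2 \<subset> LS_set ?X \<mu>2"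
      using \<mu>2(2,3) Q_nonempty by auto
    show "\<forall>m. tv_norm (borel_algebra ?X) (restrict_signed (\<mu>4 m) (L_set ?X \<mu>4)) = 1"
      using \<mu>4(2,6) by simp
    show "\<forall>F. finite F \<longrightarrow> F \<subseteq> LS_set ?X \<mu>2 \<longrightarrow>
        (\<Sum>x\<in>F. limsup (\<lambda>n. ereal (\<mu>2 n {x}))) = ereal (real (card F) / 2)"
      using finite_sum by blast
    show "\<forall>x\<in>LS_set ?X \<mu>2. \<forall>n. \<mu>2 n {x} \<in> {0, 1/2}"
      using \<mu>2(5) by blast
    show "\<forall>x\<in>LS_set ?X \<mu>2. limsup (\<lambda>n. ereal (\<mu>2 n {x})) = ereal (1/2)"
      using \<mu>2(6) by blast
    show "(1 - \<alpha>) / 2 \<le> 1/2"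
      using assms by simp
  qed (rule \<mu>1 \<mu>2(1,2,4) infinite_sum \<mu>3(1,2) eq3 \<mu>3(4-6) \<mu>4(1,2) eq4)+
qed

end
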